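(* Let $A\in M_n(\mathbb C)$ and let $u\in\mathbb C^n$, $\|u\|=1$, be such that $[u]$ is a critical point of $\rho_A$ on $\mathbb{CP}^{n-1}$. Then exactly one of the following alternatives holds. \begin{enumerate} \item $\rho_A(u)=0$. In this case $R_A(u)=0$, so $u$ is an eigenvector of $A$. \item $\rho_A(u)>0$. In this case $u$ has a strictly descending projective tangent direction. More precisely, there exists a horizontal tangent vector $h\in\mathbb C^n$ satisfying $u^*h=0$ and $\|h\|=1$ such that, with the convention \[ \rho_A(u_h(t))=\rho_A(u)+\frac{t^2}{2}\operatorname{Hess}\rho_A(u)[h,h]+O(t^3)\qquad(t\to0), \] one has \[ \operatorname{Hess}\rho_A(u)[h,h]\le -2\rho_A(u). \] \end{enumerate} Consequently, no critical point with positive residual can be a local minimum of $\rho_A$ on $\mathbb{CP}^{n-1}$.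
   Context: For $A\in M_n(\mathbb C)$ (an arbitrary complex $n\times n$ matrix) and a unit vector $u\in\mathbb C^n$ put \[ z_A(u)=u^*Au,\qquad R_A(u)=Au-z_A(u)u,\qquad \rho_A(u)=\|R_A(u)\|^2 . \] Since $\rho_A(e^{i\theta}u)=\rho_A(u)$ for all real $\theta$, $\rho_A$ descends to a smooth function on $\mathbb{CP}^{n-1}$, also denoted $\rho_A$; $[u]$ is the class of $u$. The tangent space of $\mathbb{CP}^{n-1}$ at $[u]$ is identified with the horizontal space $H_u=\{h\in\mathbb C^n: u^*h=0\}$. For $h\in H_u$ with $\|h\|=1$, $u_h(t)=(u+th)/\|u+th\|$ is the normalized curve through $u$ in direction $h$. *)

theory Defs
  imports "HOL-Analysis.Analysis" "HOL-Library.Landau_Symbols"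
begin

text \<open>The Hermitian product \<open>u\<^sup>* v\<close>, conjugate-linear in the first argument; the norm of
  \<open>complex ^ 'n\<close> is the associated one.\<close>

definition cdot :: "complex ^ 'n \<Rightarrow> complex ^ 'n \<Rightarrow> complex" where
  "cdot u v = (\<Sum>i\<in>UNIV. cnj (u $ i) * v $ i)"

definition zval :: "complex ^ 'n ^ 'n \<Rightarrow> complex ^ 'n \<Rightarrow> complex" where
  "zval A u = cdot u (A *v u)"

definition resid :: "complex ^ 'n ^ 'n \<Rightarrow> complex ^ 'n \<Rightarrow> complex ^ 'n" where
  "resid A u = A *v u - zval A u *s u"

definition rho :: "complex ^ 'n ^ 'n \<Rightarrow> complex ^ 'n \<Rightarrow> real" where
  "rho A u = (norm (resid A u))\<^sup>2"

definition eigenvector :: "complex ^ 'n ^ 'n \<Rightarrow> complex ^ 'n \<Rightarrow> bool" where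
  "eigenvector A u \<longleftrightarrow> u \<noteq> 0 \<and> (\<exists>c. A *v u = c *s u)"

definition horizontal :: "complex ^ 'n \<Rightarrow> (complex ^ 'n) set" where
  "horizontal u = {h. cdot u h = 0}"

definition hcurve :: "complex ^ 'n \<Rightarrow> complex ^ 'n \<Rightarrow> real \<Rightarrow> complex ^ 'n" where
  "hcurve u h t = (u + t *\<^sub>R h) /\<^sub>R norm (u + t *\<^sub>R h)"


lemma vsmult_cis_norm: "norm (cis \<theta> *s u) = norm (u :: complex ^ 'n)"
  by (simp add: norm_vec_def norm_mult)

lemma cdot_smult_right: "cdot u (c *s v) = c * cdot u v"
  by (simp add: cdot_def sum_distrib_left algebra_simps)

lemma cdot_smult_left: "cdot (c *s u) v = cnj c * cdot u v"
  by (simp add: cdot_def sum_distrib_left algebra_simps)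

lemma cdot_add: "cdot (u + v) w = cdot u w + cdot v w" "cdot w (u + v) = cdot w u + cdot w v"
  by (simp_all add: cdot_def distrib_left distrib_right sum.distrib)

lemma cdot_self: "cdot u u = complex_of_real ((norm u)\<^sup>2)"
  by (simp add: cdot_def norm_vec_def L2_set_def sum_nonneg complex_norm_square mult.commute
      del: of_real_power)

lemma matrix_vector_mult_smult: "(A :: complex ^ 'n ^ 'n) *v (c *s u) = c *s (A *v u)"
  by (simp add: vec_eq_iff matrix_vector_mult_def sum_distrib_left algebra_simps)

lemma rho_phase: "rho A (cis \<theta> *s u) = rho A u"
proof -
  have "zval A (cis \<theta> *s u) = zval A u"
    by (simp add: zval_def matrix_vector_mult_smult cdot_smult_left cdot_smult_right
        cis_cnj cis_mult flip: mult.assoc)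
  then have "resid A (cis \<theta> *s u) = cis \<theta> *s resid A u"
    by (simp add: resid_def matrix_vector_mult_smult vec_eq_iff algebra_simps)
  then show ?thesis
    by (simp add: rho_def vsmult_cis_norm)
qed


text \<open>Complex projective space: unit vectors modulo phases. For \<open>'n\<close> of cardinality \<open>n\<close>,
  the type \<open>'n cproj\<close> is \<open>\<complex>\<P>\<close> of dimension \<open>n - 1\<close>.\<close>

definition phase_rel :: "complex ^ 'n \<Rightarrow> complex ^ 'n \<Rightarrow> bool" where
  "phase_rel u v \<longleftrightarrow> norm u = 1 \<and> norm v = 1 \<and> (\<exists>\<theta>::real. v = cis \<theta> *s u)"

lemma phase_rel_part_equivp: "part_equivp (phase_rel :: complex ^ 'n \<Rightarrow> _)"
proof (rule part_equivpI)
  have "phase_rel (axis undefined 1 :: complex ^ 'n) (axis undefined 1)"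
    unfolding phase_rel_def by (auto simp: norm_axis_1 intro!: exI[of _ 0])
  then show "\<exists>x :: complex ^ 'n. phase_rel x x" by blast
  show "symp (phase_rel :: complex ^ 'n \<Rightarrow> _)"
  proof (rule sympI)
    fix x y :: "complex ^ 'n"
    assume "phase_rel x y"
    then obtain \<theta> where *: "norm x = 1" "norm y = 1" "y = cis \<theta> *s x"
      unfolding phase_rel_def by blast
    then have "x = cis (- \<theta>) *s y"
      by (simp add: vector_smult_assoc cis_mult)
    with * show "phase_rel y x" unfolding phase_rel_def by blast
  qed
  show "transp (phase_rel :: complex ^ 'n \<Rightarrow> _)"
  proof (rule transpI)
    fix x y z :: "complex ^ 'n"
    assume "phase_rel x y" "phase_rel y z"
    then obtain \<theta> \<eta> where *: "norm x = 1" "norm z = 1" "y = cis \<theta> *s x" "z = cis \<eta> *s y"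
      unfolding phase_rel_def by blast
    then have "z = cis (\<eta> + \<theta>) *s x"
      by (simp add: vector_smult_assoc cis_mult)
    with * show "phase_rel x z" unfolding phase_rel_def by blast
  qed
qed

quotient_type (overloaded) 'n cproj = "complex ^ ('n :: finite)" / partial: phase_rel
  morphisms rep_cproj cproj_class
  by (rule phase_rel_part_equivp)

lemma cproj_class_eq_iff:
  assumes "norm u = 1" "norm v = 1"
  shows "cproj_class u = cproj_class v \<longleftrightarrow> (\<exists>\<theta>::real. v = cis \<theta> *s u)"
proof -
  have refl: "phase_rel w w" if "norm w = 1" for w :: "complex ^ 'a"
    using that unfolding phase_rel_def by (auto intro!: exI[of _ 0])
  show ?thesis
    using Quotient_rel[OF Quotient_cproj, of u v] refl[OF assms(1)] refl[OF assms(2)] assms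
    unfolding phase_rel_def by blast
qed

lemma cproj_class_surj: "\<exists>u. norm u = 1 \<and> p = cproj_class u"
proof (intro exI conjI)
  show "p = cproj_class (rep_cproj p)"
    by (rule Quotient_abs_rep[OF Quotient_cproj, symmetric])
  show "norm (rep_cproj p) = 1"
    using Quotient_rep_reflp[OF Quotient_cproj, of p] unfolding phase_rel_def by (rule conjunct1)
qed

lift_definition rho_proj :: "complex ^ 'n ^ 'n \<Rightarrow> 'n cproj \<Rightarrow> real" is rho
  by (auto simp: phase_rel_def rho_phase)

lemma rho_proj_class: "norm u = 1 \<Longrightarrow> rho_proj A (cproj_class u) = rho A u"
  by (rule rho_proj.abs_eq) (auto simp: phase_rel_def intro!: exI[of _ 0])

text \<open>The quotient topology of the unit sphere.\<close>

instantiation cproj :: (finite) topological_space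
begin

definition open_cproj :: "'a cproj set \<Rightarrow> bool" where
  "open_cproj U \<longleftrightarrow>
     openin (top_of_set (sphere 0 1)) {u \<in> sphere 0 1. cproj_class u \<in> U}"

instance
proof
  have "{u \<in> sphere 0 1. cproj_class u \<in> (UNIV :: 'a cproj set)} = sphere 0 1" by blast
  then show "open (UNIV :: 'a cproj set)"
    by (simp only: open_cproj_def openin_subtopology_self)
next
  fix S T :: "'a cproj set"
  assume "open S" "open T"
  then have "openin (top_of_set (sphere 0 1))
      ({u \<in> sphere 0 1. cproj_class u \<in> S} \<inter> {u \<in> sphere 0 1. cproj_class u \<in> T})"
    unfolding open_cproj_def by (rule openin_Int)
  also have "{u \<in> sphere 0 1. cproj_class u \<in> S} \<inter> {u \<in> sphere 0 1. cproj_class u \<in> T} =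
      {u \<in> sphere 0 1. cproj_class u \<in> S \<inter> T}" by blast
  finally show "open (S \<inter> T)" unfolding open_cproj_def .
next
  fix K :: "'a cproj set set"
  assume "\<forall>S\<in>K. open S"
  then have "openin (top_of_set (sphere 0 1))
      (\<Union>S\<in>K. {u \<in> sphere 0 1. cproj_class u \<in> S})"
    unfolding open_cproj_def by (intro openin_Union) auto
  also have "(\<Union>S\<in>K. {u \<in> sphere 0 1. cproj_class u \<in> S}) =
      {u \<in> sphere 0 1. cproj_class u \<in> \<Union>K}" by blast
  finally show "open (\<Union>K)" unfolding open_cproj_def .
qed

end

definition cproj_local_min :: "(('n :: finite) cproj \<Rightarrow> real) \<Rightarrow> 'n cproj \<Rightarrow> bool" where
  "cproj_local_min f p \<longleftrightarrow> (\<forall>\<^sub>F q in nhds p. f p \<le> f q)"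

text \<open>The affine chart centred at \<open>[u]\<close>, defined on the horizontal space of \<open>u\<close>.
  It is \<open>h \<mapsto> [u + h]\<close>, with the representative normalized.\<close>

definition cproj_chart :: "complex ^ 'n \<Rightarrow> complex ^ 'n \<Rightarrow> 'n cproj" where
  "cproj_chart u h = cproj_class ((u + h) /\<^sub>R norm (u + h))"

lemma cproj_chart_hcurve: "cproj_chart u (t *\<^sub>R h) = cproj_class (hcurve u h t)"
  by (simp add: cproj_chart_def hcurve_def)

text \<open>A point is critical if the differential vanishes on the tangent space there, the latter
  being identified with the horizontal space of a representative. The choice of the
  representative is immaterial, see \<open>cproj_critical_class\<close> below.\<close>

definition cproj_critical :: "(('n :: finite) cproj \<Rightarrow> real) \<Rightarrow> 'n cproj \<Rightarrow> bool" where
  "cproj_critical f p \<longleftrightarrow>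
     (\<forall>u. norm u = 1 \<and> p = cproj_class u \<longrightarrow>
        ((\<lambda>h. f (cproj_chart u h)) has_derivative (\<lambda>_. 0)) (at 0 within horizontal u))"

lemma norm_add_horizontal:
  assumes "norm u = 1" "h \<in> horizontal u"
  shows "(norm (u + h))\<^sup>2 = 1 + (norm h)\<^sup>2"
proof -
  have "cdot h u = cnj (cdot u h)"
    by (simp add: cdot_def mult.commute)
  also have "\<dots> = 0"
    using assms(2) by (simp add: horizontal_def)
  finally have "cdot (u + h) (u + h) = cdot u u + cdot h h"
    using assms(2) by (simp add: horizontal_def cdot_add)
  then have "complex_of_real ((norm (u + h))\<^sup>2) = complex_of_real ((norm u)\<^sup>2 + (norm h)\<^sup>2)"
    by (simp add: cdot_self)
  then show ?thesis using assms(1) by (simp only: of_real_eq_iff) simp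
qed

lemma norm_hcurve:
  assumes "norm u = 1" "h \<in> horizontal u"
  shows "norm (hcurve u h t) = 1"
proof -
  have "t *\<^sub>R h \<in> horizontal u"
    using assms(2) by (simp add: horizontal_def cdot_def flip: scaleR_right.sum)
  then have "(norm (u + t *\<^sub>R h))\<^sup>2 = 1 + (norm (t *\<^sub>R h))\<^sup>2"
    using norm_add_horizontal assms(1) by blast
  then have "norm (u + t *\<^sub>R h) \<noteq> 0"
    by (smt (verit) zero_le_power2 zero_power2)
  then show ?thesis by (simp add: hcurve_def)
qed

lemma cproj_chart_phase:
  assumes "norm u = 1" "h \<in> horizontal u"
  shows "cproj_chart (cis \<theta> *s u) (cis \<theta> *s h) = cproj_chart u h"
proof -
  have *: "cis \<theta> *s u + cis \<theta> *s h = cis \<theta> *s (u + h)"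
    by (simp add: vec_eq_iff distrib_left)
  let ?w = "(u + h) /\<^sub>R norm (u + h)"
  have w: "norm ?w = 1"
    using norm_hcurve[OF assms, of 1] by (simp add: hcurve_def)
  have "cproj_chart (cis \<theta> *s u) (cis \<theta> *s h) =
      cproj_class ((cis \<theta> *s (u + h)) /\<^sub>R norm (u + h))"
    unfolding cproj_chart_def * vsmult_cis_norm ..
  also have "(cis \<theta> *s (u + h)) /\<^sub>R norm (u + h) = cis \<theta> *s ?w"
    unfolding vec_eq_iff by (simp add: distrib_left)
  also have "cproj_class (cis \<theta> *s ?w) = cproj_class ?w"
    using cproj_class_eq_iff[of ?w "cis \<theta> *s ?w"] w by (auto simp: vsmult_cis_norm)
  also have "\<dots> = cproj_chart u h"
    unfolding cproj_chart_def ..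
  finally show ?thesis .
qed

lemma cproj_critical_class:
  assumes "norm u = 1"
  shows "cproj_critical f (cproj_class u) \<longleftrightarrow>
    ((\<lambda>h. f (cproj_chart u h)) has_derivative (\<lambda>_. 0)) (at 0 within horizontal u)"
    (is "_ \<longleftrightarrow> ?D u")
proof
  assume "cproj_critical f (cproj_class u)"
  then show "?D u" using assms by (auto simp: cproj_critical_def)
next
  assume D: "?D u"
  have "?D v" if v: "norm v = 1" "cproj_class u = cproj_class v" for v
  proof -
    obtain \<theta> where \<theta>: "v = cis \<theta> *s u"
      using v assms cproj_class_eq_iff by blast
    let ?g = "\<lambda>h :: complex ^ 'a. cis (- \<theta>) *s h"
    have bl: "bounded_linear ?g"
      by (rule bounded_linear_intro[where K = 1])
        (auto simp: vsmult_cis_norm vec_eq_iff algebra_simps)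
    have hor: "?g h \<in> horizontal u" if "h \<in> horizontal v" for h
      using that by (simp add: \<theta> horizontal_def cdot_smult_left cdot_smult_right)
    have D': "((\<lambda>h. f (cproj_chart u (?g h))) has_derivative (\<lambda>h. 0)) (at 0 within horizontal v)"
    proof (rule has_derivative_in_compose[where f = ?g and g' = "\<lambda>_. 0"])
      show "(?g has_derivative ?g) (at 0 within horizontal v)"
        using bl by (rule bounded_linear_imp_has_derivative)
      show "((\<lambda>h. f (cproj_chart u h)) has_derivative (\<lambda>_. 0))
          (at (?g 0) within ?g ` horizontal v)"
        using D hor by (auto intro: has_derivative_subset)
    qed
    have eq: "cproj_chart u (?g h) = cproj_chart v h" if "h \<in> horizontal v" for h
    proof -
      have "cis \<theta> *s ?g h = h" by (simp add: vector_smult_assoc cis_mult)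
      then show ?thesis
        using cproj_chart_phase[OF assms hor[OF that], of \<theta>] by (simp add: \<theta>)
    qed
    have zero: "0 \<in> horizontal v" by (simp add: horizontal_def cdot_def)
    show ?thesis
      by (rule has_derivative_transform[OF zero _ D']) (simp add: eq)
  qed
  then show "cproj_critical f (cproj_class u)"
    by (auto simp: cproj_critical_def)
qed

text \<open>The quadratic form of the Hessian at a critical point is the coefficient in the second-order
  expansion along \<open>hcurve u h\<close>; there is no first-order term, so the expansion can only hold
  where the derivative in direction \<open>h\<close> vanishes.\<close>

definition rho_expansion ::
    "complex ^ 'n ^ 'n \<Rightarrow> complex ^ 'n \<Rightarrow> complex ^ 'n \<Rightarrow> real \<Rightarrow> bool" where
  "rho_expansion A u h c \<longleftrightarrow>
     (\<lambda>t. rho A (hcurve u h t) - (rho A u + t\<^sup>2 / 2 * c)) \<in> O[at 0](\<lambda>t. t ^ 3)"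

definition hess_rho ::
    "complex ^ 'n ^ 'n \<Rightarrow> complex ^ 'n \<Rightarrow> complex ^ 'n \<Rightarrow> real" where
  "hess_rho A u h = (THE c. rho_expansion A u h c)"

lemma rho_expansion_unique:
  assumes "rho_expansion A u h c" "rho_expansion A u h d"
  shows "c = d"
proof -
  define e where "e = (d - c) / 2"
  have "(\<lambda>t. (rho A (hcurve u h t) - (rho A u + t\<^sup>2 / 2 * c))
           - (rho A (hcurve u h t) - (rho A u + t\<^sup>2 / 2 * d))) \<in> O[at 0](\<lambda>t::real. t ^ 3)"
    using assms unfolding rho_expansion_def by (rule sum_in_bigo)
  moreover have "(r - (q + s / 2 * c)) - (r - (q + s / 2 * d)) = e * s" for q r s :: real
    by (simp add: e_def left_diff_distrib right_diff_distrib diff_divide_distrib mult.commute[of s])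
  ultimately have "(\<lambda>t. e * t\<^sup>2) \<in> O[at 0](\<lambda>t::real. t ^ 3)"
    by (simp only:)
  then obtain K where K: "\<forall>\<^sub>F t in at 0. norm (e * t\<^sup>2) \<le> K * norm (t ^ 3 :: real)"
    by (rule landau_o.bigE)
  have "\<forall>\<^sub>F t in at (0::real). t \<noteq> 0"
    by (simp add: eventually_at_filter)
  with K have "\<forall>\<^sub>F t in at (0::real). \<bar>e\<bar> \<le> K * \<bar>t\<bar>"
  proof eventually_elim
    case (elim t)
    have "\<bar>e\<bar> * t\<^sup>2 \<le> (K * \<bar>t\<bar>) * t\<^sup>2"
      using elim(1) by (simp add: abs_mult power3_eq_cube power2_eq_square mult.assoc)
    then show ?case
      by (rule mult_right_le_imp_le) (use elim(2) in simp)
  qed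
  then have "\<bar>e\<bar> \<le> K * \<bar>0\<bar>"
  proof (rule tendsto_lowerbound[rotated])
    show "((\<lambda>t. K * \<bar>t\<bar>) \<longlongrightarrow> K * \<bar>0\<bar>) (at (0::real))"
      by (intro tendsto_intros)
  qed simp
  then show ?thesis by (simp add: e_def)
qed

lemma hess_rho_eq: "rho_expansion A u h c \<Longrightarrow> hess_rho A u h = c"
  unfolding hess_rho_def using rho_expansion_unique by blast

end

theory Submission
  imports Defs
begin

text \<open>
  Subtracting \<open>z_A(u)\<close> from the diagonal of \<open>A\<close> does not change the residual of any unit vector,
  so let \<open>B = A - z_A(u) I\<close>. Then \<open>u\<^sup>* B u = 0\<close> and the residual at \<open>u\<close> is \<open>r = B u\<close>, which is
  orthogonal to \<open>u\<close>. For a unit vector \<open>v\<close> the residual is a variance,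
  \<open>\<rho>(v) = \<parallel>B v\<parallel>\<^sup>2 - \<bar>v\<^sup>* B v\<bar>\<^sup>2\<close>. Along the normalized curve in a horizontal direction \<open>h\<close> it is
  therefore an explicit rational function of \<open>t\<close> (\<open>rho_hcurve\<close>). Its derivative at \<open>0\<close> is
  \<open>2 Re (r\<^sup>* B h)\<close>, and if this vanishes and \<open>h\<close> is a unit vector, then
  \<open>Hess[h, h] = 2 (\<parallel>B h\<parallel>\<^sup>2 - \<rho> - \<bar>u\<^sup>* B h + h\<^sup>* r\<bar>\<^sup>2)\<close>.
  So a direction with \<open>\<parallel>B h\<parallel> \<le> \<bar>u\<^sup>* B h + h\<^sup>* r\<bar>\<close> is wanted.

  Criticality in all horizontal directions \<open>h\<close> and \<open>\<i> h\<close> says that \<open>B\<^sup>* r\<close> is a multiple of \<open>u\<close>,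
  and pairing with \<open>u\<close> identifies it: \<open>B\<^sup>* r = \<rho> u\<close> (\<open>residual_adjoint_at_critical\<close>). Whether \<open>B\<close>
  is invertible or not, some \<open>x \<noteq> 0\<close> is mapped into the line of \<open>u\<close>
  (\<open>exists_vector_mapped_into_line\<close>). Such an \<open>x\<close> is automatically horizontal if \<open>\<rho> > 0\<close>:
  \<open>\<rho> u\<^sup>* x = r\<^sup>* B x\<close> is a multiple of \<open>r\<^sup>* u = 0\<close>. Normalize it to \<open>h\<close>, with \<open>B h = \<lambda> u\<close>. Then
  \<open>\<parallel>B h\<parallel> = \<bar>\<lambda>\<bar> = \<bar>u\<^sup>* B h\<bar>\<close>, so the wanted inequality holds as soon as the cross term
  \<open>Re (cnj \<lambda> (h\<^sup>* r))\<close> is nonnegative. Replacing \<open>h\<close> by \<open>\<i> h\<close> changes the sign of that term,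
  because \<open>\<lambda>\<close> is linear and \<open>h\<^sup>* r\<close> is conjugate-linear in \<open>h\<close>; hence one of \<open>h\<close> and \<open>\<i> h\<close>
  works (\<open>exists_descent_direction\<close>). The negative second-order coefficient makes \<open>\<rho>\<close> smaller at
  points of \<open>\<complex>\<P>\<close> arbitrarily close to \<open>[u]\<close>.
\<close>

section \<open>The Hermitian product\<close>

lemma cdot_cnj: "cdot v u = cnj (cdot u v)"
  by (simp add: cdot_def mult.commute)

lemma cdot_scaleR: "cdot (t *\<^sub>R u) v = of_real t * cdot u v" "cdot u (t *\<^sub>R v) = of_real t * cdot u v"
  by (simp_all add: cdot_def sum_distrib_left scaleR_conv_of_real[where 'a = complex] algebra_simps)

lemma cdot_diff_right: "cdot u (v - w) = cdot u v - cdot u w"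
  by (simp add: cdot_def algebra_simps sum_subtractf)

lemma Re_cdot: "Re (cdot u v) = u \<bullet> v"
  by (simp add: cdot_def inner_vec_def inner_complex_def)

lemma norm_add_squared: "(norm (a + b))\<^sup>2 = (norm a)\<^sup>2 + 2 * (a \<bullet> b) + (norm b)\<^sup>2"
  for a b :: "'a :: real_inner"
  by (simp add: power2_norm_eq_inner inner_add_left inner_add_right inner_commute)

lemma norm_affine_squared:
  "(norm (a + of_real t * b))\<^sup>2 = (norm a)\<^sup>2 + t * (2 * (a \<bullet> b)) + t\<^sup>2 * (norm b)\<^sup>2"
  for a b :: complex
  by (simp add: norm_add_squared norm_mult power_mult_distrib flip: scaleR_conv_of_real)

lemma norm_vsmult: "norm (c *s u) = norm c * norm (u :: complex ^ 'n)"
  by (simp add: norm_vec_def norm_mult L2_set_right_distrib)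

lemma matrix_vector_mult_scaleR: "(A :: complex ^ 'n ^ 'n) *v (t *\<^sub>R u) = t *\<^sub>R (A *v u)"
  by (simp add: vec_eq_iff matrix_vector_mult_def scaleR_right.sum)

lemma mat_vector_mult: "mat c *v x = c *s (x :: complex ^ 'n)"
  by (simp add: vec_eq_iff matrix_vector_mult_def mat_def if_distrib [of "\<lambda>a. a * _"] cong: if_cong)

section \<open>The residual along a normalized curve\<close>

text \<open>Pythagoras: \<open>A v\<close> is the sum of its component along \<open>v\<close> and the residual, which is orthogonal
  to \<open>v\<close>.\<close>

lemma rho_eq_variance:
  assumes "norm v = 1"
  shows "rho A v = (norm (A *v v))\<^sup>2 - (norm (zval A v))\<^sup>2"
proof -
  let ?z = "zval A v"
  have "cdot (resid A v) v = 0"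
    using assms
    by (subst cdot_cnj) (simp add: resid_def cdot_diff_right cdot_smult_right cdot_self flip: zval_def)
  then have "resid A v \<bullet> (?z *s v) = 0"
    by (simp add: cdot_smult_right flip: Re_cdot)
  then have "(norm (resid A v + ?z *s v))\<^sup>2 = (norm (resid A v))\<^sup>2 + (norm (?z *s v))\<^sup>2"
    by (simp add: norm_add_squared)
  then show ?thesis
    using assms by (simp add: rho_def resid_def norm_vsmult)
qed

text \<open>This invariance is what allows the normalization \<open>zval A u = 0\<close> below.\<close>

lemma resid_shift:
  assumes "norm v = 1"
  shows "zval (A - mat c) v = zval A v - c" "resid (A - mat c) v = resid A v"
proof -
  show z: "zval (A - mat c) v = zval A v - c"
    using assms
    by (simp add: zval_def matrix_vector_mult_diff_rdistrib mat_vector_mult cdot_diff_right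
        cdot_smult_right cdot_self)
  show "resid (A - mat c) v = resid A v"
    unfolding resid_def z
    by (simp add: matrix_vector_mult_diff_rdistrib mat_vector_mult vec_eq_iff algebra_simps)
qed

lemma rho_shift: "norm v = 1 \<Longrightarrow> rho (A - mat c) v = rho A v"
  by (simp add: rho_def resid_shift)

text \<open>The variance formula is homogeneous, so it can be evaluated at the unnormalized vector
  \<open>u + t h\<close>, whose squared norm is \<open>1 + t\<^sup>2 \<parallel>h\<parallel>\<^sup>2\<close>. Because of \<open>zval A u = 0\<close> the Rayleigh term has
  no constant part and carries the factor \<open>t\<^sup>2\<close>.\<close>

lemma rho_hcurve:
  assumes u: "norm u = 1" and h: "cdot u h = 0" and z: "zval A u = 0"
  shows "rho A (hcurve u h t) =
    (rho A u + 2 * t * ((A *v u) \<bullet> (A *v h)) + t\<^sup>2 * (norm (A *v h))\<^sup>2) / (1 + t\<^sup>2 * (norm h)\<^sup>2)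
    - t\<^sup>2 * (norm (cdot u (A *v h) + cdot h (A *v u) + of_real t * cdot h (A *v h)))\<^sup>2
        / (1 + t\<^sup>2 * (norm h)\<^sup>2)\<^sup>2"
proof -
  let ?w = "u + t *\<^sub>R h"
  let ?g = "cdot u (A *v h) + cdot h (A *v u) + of_real t * cdot h (A *v h)"
  have hor: "h \<in> horizontal u" using h by (simp add: horizontal_def)
  have "cdot u (t *\<^sub>R h) = 0" using h by (simp add: cdot_scaleR)
  then have nw: "(norm ?w)\<^sup>2 = 1 + t\<^sup>2 * (norm h)\<^sup>2"
    using norm_add_horizontal[OF u, of "t *\<^sub>R h"] by (simp add: horizontal_def power_mult_distrib)
  have Aw: "A *v ?w = A *v u + t *\<^sub>R (A *v h)"
    by (simp add: matrix_vector_right_distrib matrix_vector_mult_scaleR)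
  have ru: "rho A u = (norm (A *v u))\<^sup>2"
    using u z by (simp add: rho_eq_variance)
  have n1: "(norm (A *v ?w))\<^sup>2 = rho A u + 2 * t * ((A *v u) \<bullet> (A *v h)) + t\<^sup>2 * (norm (A *v h))\<^sup>2"
    unfolding Aw ru by (simp add: norm_add_squared power_mult_distrib)
  have "cdot ?w (A *v ?w) = of_real t * ?g"
    unfolding Aw using z by (simp add: cdot_add cdot_scaleR zval_def algebra_simps)
  then have n2: "(norm (cdot ?w (A *v ?w)))\<^sup>2 = t\<^sup>2 * (norm ?g)\<^sup>2"
    by (simp add: norm_mult power_mult_distrib)
  have "norm (A *v hcurve u h t) = norm (A *v ?w) / norm ?w"
    by (simp add: hcurve_def matrix_vector_mult_scaleR divide_inverse mult.commute)
  moreover have "norm (zval A (hcurve u h t)) = norm (cdot ?w (A *v ?w)) / (norm ?w)\<^sup>2"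
    by (simp add: hcurve_def zval_def matrix_vector_mult_scaleR cdot_scaleR norm_mult norm_inverse
        divide_inverse power2_eq_square)
  ultimately show ?thesis
    unfolding rho_eq_variance[OF norm_hcurve[OF u hor]] by (simp only: power_divide n1 n2 nw)
qed

lemma rho_hcurve_derivative:
  assumes "norm u = 1" "cdot u h = 0" "zval A u = 0"
  shows "((\<lambda>t. rho A (hcurve u h t)) has_real_derivative 2 * ((A *v u) \<bullet> (A *v h))) (at 0)"
  unfolding rho_hcurve[OF assms] norm_affine_squared
  by (auto intro!: derivative_eq_intros)

lemma rho_expansion_critical_direction:
  assumes "norm u = 1" "cdot u h = 0" "zval A u = 0" and crit: "(A *v u) \<bullet> (A *v h) = 0"
  shows "rho_expansion A u h
    (2 * ((norm (A *v h))\<^sup>2 - rho A u * (norm h)\<^sup>2 - (norm (cdot u (A *v h) + cdot h (A *v u)))\<^sup>2))"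
proof -
  define \<rho> k b where "\<rho> = rho A u" and "k = (norm h)\<^sup>2" and "b = (norm (A *v h))\<^sup>2"
  define a d where "a = cdot u (A *v h) + cdot h (A *v u)" and "d = cdot h (A *v h)"
  define c where "c = b - \<rho> * k - (norm a)\<^sup>2"
  \<comment> \<open>The error term, multiplied by the square of \<open>1 + t\<^sup>2 * k\<close>, is the polynomial \<open>t^3 * P t\<close>.\<close>
  define P where "P = (\<lambda>t. - (2 * (a \<bullet> d)) + t * (k * b - (norm d)\<^sup>2 - 2 * k * c - k\<^sup>2 * \<rho>) - t^3 * (k\<^sup>2 * c))"
  have eq: "rho A (hcurve u h t) - (rho A u + t\<^sup>2 / 2 * (2 * c)) = t^3 * (P t / (1 + t\<^sup>2 * k)\<^sup>2)" for t
  proof -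
    have "1 + t\<^sup>2 * k > 0" by (simp add: k_def add_pos_nonneg)
    then have s: "1 + t\<^sup>2 * k \<noteq> 0" by linarith
    have common_denominator: "x / s - y / s\<^sup>2 - q = (x * s - y - q * s\<^sup>2) / s\<^sup>2"
      if "s \<noteq> 0" for x y q s :: real
      using that by (simp add: field_simps power2_eq_square)
    have "rho A (hcurve u h t) - (rho A u + t\<^sup>2 / 2 * (2 * c)) = (\<rho> + t\<^sup>2 * b) / (1 + t\<^sup>2 * k)
       - t\<^sup>2 * ((norm a)\<^sup>2 + t * (2 * (a \<bullet> d)) + t\<^sup>2 * (norm d)\<^sup>2) / (1 + t\<^sup>2 * k)\<^sup>2
       - (\<rho> + t\<^sup>2 * c)"
      unfolding rho_hcurve[OF assms(1-3)] crit norm_affine_squared[symmetric]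
      by (simp add: \<rho>_def k_def b_def a_def d_def)
    also have "\<dots> = ((\<rho> + t\<^sup>2 * b) * (1 + t\<^sup>2 * k)
         - t\<^sup>2 * ((norm a)\<^sup>2 + t * (2 * (a \<bullet> d)) + t\<^sup>2 * (norm d)\<^sup>2)
         - (\<rho> + t\<^sup>2 * c) * (1 + t\<^sup>2 * k)\<^sup>2) / (1 + t\<^sup>2 * k)\<^sup>2"
      by (rule common_denominator[OF s])
    also have "(\<rho> + t\<^sup>2 * b) * (1 + t\<^sup>2 * k)
         - t\<^sup>2 * ((norm a)\<^sup>2 + t * (2 * (a \<bullet> d)) + t\<^sup>2 * (norm d)\<^sup>2)
         - (\<rho> + t\<^sup>2 * c) * (1 + t\<^sup>2 * k)\<^sup>2 = t^3 * P t"
      unfolding P_def c_def by algebra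
    finally show ?thesis by simp
  qed
  have "((\<lambda>t. P t / (1 + t\<^sup>2 * k)\<^sup>2) \<longlongrightarrow> P 0 / (1 + 0\<^sup>2 * k)\<^sup>2) (at 0)"
    unfolding P_def by (intro tendsto_intros) auto
  then have "(\<lambda>t. P t / (1 + t\<^sup>2 * k)\<^sup>2) \<in> O[at 0](\<lambda>_. 1)"
    by (intro bigoI_tendsto[where c = "P 0 / (1 + 0\<^sup>2 * k)\<^sup>2"]) auto
  then have "(\<lambda>t. t^3 * (P t / (1 + t\<^sup>2 * k)\<^sup>2)) \<in> O[at 0](\<lambda>t. t^3 * 1)"
    by (intro landau_o.big.mult) auto
  then show ?thesis
    unfolding rho_expansion_def eq[unfolded c_def \<rho>_def k_def b_def a_def]
    by (simp add: c_def \<rho>_def k_def b_def a_def)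
qed

section \<open>Critical points\<close>

text \<open>The curve is the image of the line \<open>t h\<close> under the affine chart centred at \<open>[u]\<close>.\<close>

lemma cproj_critical_derivative:
  assumes u: "norm u = 1" and crit: "cproj_critical (rho_proj A) (cproj_class u)" and h: "cdot u h = 0"
  shows "((\<lambda>t. rho A (hcurve u h t)) has_real_derivative 0) (at 0)"
proof -
  let ?f = "\<lambda>h. rho_proj A (cproj_chart u h)"
  let ?l = "\<lambda>t::real. t *\<^sub>R h"
  have hor: "h \<in> horizontal u" "range ?l \<subseteq> horizontal u" using h by (auto simp: horizontal_def cdot_scaleR)
  have "(?f has_derivative (\<lambda>_. 0)) (at 0 within horizontal u)"
    using crit u by (simp add: cproj_critical_class)
  then have D: "(?f has_derivative (\<lambda>_. 0)) (at (?l 0) within range ?l)"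
    using hor by (simp add: has_derivative_subset)
  have "(?l has_derivative ?l) (at 0)"
    by (auto intro!: derivative_eq_intros)
  from has_derivative_in_compose[OF this D]
  have "((\<lambda>t. ?f (?l t)) has_derivative (\<lambda>_. 0)) (at 0)" .
  then show ?thesis
    by (simp add: cproj_chart_hcurve rho_proj_class norm_hcurve[OF u hor(1)] has_field_derivative_def
        lambda_zero)
qed

text \<open>This is the identity \<open>B\<^sup>* r = \<rho> u\<close> for \<open>r = B u\<close>, tested against \<open>x\<close>. Stationarity only speaks
  about real parts; applying it to \<open>h\<close> and \<open>\<i> h\<close> gives \<open>r\<^sup>* B h = 0\<close> for horizontal \<open>h\<close>, so only the
  component of \<open>x\<close> along \<open>u\<close> contributes.\<close>

lemma residual_adjoint_at_critical:
  assumes u: "norm u = 1" and z: "zval B u = 0"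
    and crit: "\<And>h. cdot u h = 0 \<Longrightarrow> (B *v u) \<bullet> (B *v h) = 0"
  shows "cdot (B *v u) (B *v x) = of_real (rho B u) * cdot u x"
proof -
  define h where "h = x - cdot u x *s u"
  have h: "cdot u h = 0"
    using u by (simp add: h_def cdot_diff_right cdot_smult_right cdot_self)
  have "Re (cdot (B *v u) (B *v h)) = 0"
    using crit[OF h] by (simp add: Re_cdot)
  moreover have "Re (cdot (B *v u) (B *v (\<i> *s h))) = 0"
    using crit[of "\<i> *s h"] h by (simp add: Re_cdot cdot_smult_right)
  ultimately have "cdot (B *v u) (B *v h) = 0"
    by (simp add: matrix_vector_mult_smult cdot_smult_right complex_eq_iff)
  moreover have "B *v h = B *v x - cdot u x *s (B *v u)"
    by (simp add: h_def matrix_vector_mult_diff_distrib matrix_vector_mult_smult)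
  moreover have "rho B u = (norm (B *v u))\<^sup>2"
    using u z by (simp add: rho_eq_variance)
  ultimately show ?thesis
    by (simp add: cdot_diff_right cdot_smult_right cdot_self)
qed

text \<open>A kernel vector if \<open>B\<close> is singular, and otherwise the preimage of \<open>u\<close>.\<close>

lemma exists_vector_mapped_into_line:
  fixes B :: "complex ^ 'n ^ 'n"
  assumes "u \<noteq> 0"
  shows "\<exists>x c. x \<noteq> 0 \<and> B *v x = c *s u"
proof (cases "inj ((*v) B)")
  case False
  then obtain x y where "x \<noteq> y" "B *v x = B *v y" by (auto simp: inj_def)
  then have "x - y \<noteq> 0" "B *v (x - y) = 0 *s u"
    by (simp_all add: matrix_vector_mult_diff_distrib)
  then show ?thesis by blast
next
  case True
  then obtain C where "C ** B = mat 1"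
    using matrix_left_invertible_injective by blast
  then have "B ** C = mat 1" by (simp add: matrix_left_right_inverse)
  then have *: "B *v (C *v u) = 1 *s u" by (simp add: matrix_vector_mul_assoc)
  moreover have "C *v u \<noteq> 0" using assms * by auto
  ultimately show ?thesis by blast
qed

text \<open>The inequality makes the Hessian at most \<open>-2 \<rho>\<close>. It is obtained from a direction with
  \<open>B h\<close> in the line of \<open>u\<close>, so that \<open>\<parallel>B h\<parallel> = \<bar>u\<^sup>* B h\<bar>\<close>; the phase of \<open>h\<close> is then used to prevent
  cancellation between the two terms on the right.\<close>

lemma exists_descent_direction:
  assumes u: "norm u = 1" and z: "zval B u = 0" and pos: "rho B u > 0"
    and adj: "\<And>x. cdot (B *v u) (B *v x) = of_real (rho B u) * cdot u x"
  shows "\<exists>h. cdot u h = 0 \<and> norm h = 1 \<and>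
    (norm (B *v h))\<^sup>2 \<le> (norm (cdot u (B *v h) + cdot h (B *v u)))\<^sup>2"
proof -
  have "u \<noteq> 0" using u by auto
  then obtain x c where x: "x \<noteq> 0" "B *v x = c *s u"
    using exists_vector_mapped_into_line by blast
  \<comment> \<open>Horizontality comes for free from the adjoint identity.\<close>
  have "cdot (B *v u) u = 0"
    using z by (subst cdot_cnj) (simp add: zval_def)
  then have "cdot u x = 0"
    using adj[of x] pos by (simp add: x cdot_smult_right)
  define k where "k = x /\<^sub>R norm x"
  define l where "l = c / norm x"
  define e where "e = cdot k (B *v u)"
  have k: "cdot u k = 0" "norm k = 1" "B *v k = l *s u"
    using x \<open>cdot u x = 0\<close>
    by (simp_all add: k_def l_def cdot_scaleR matrix_vector_mult_scaleR)
      (simp add: vec_eq_iff scaleR_conv_of_real[where 'a = complex] field_simps)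
  have Bk: "cdot u (B *v k) = l" "norm (B *v k) = norm l"
    using u by (simp_all add: k(3) cdot_smult_right cdot_self norm_vsmult)
  show ?thesis
  proof (cases "l \<bullet> e \<ge> 0")
    case True
    then have "(norm (B *v k))\<^sup>2 \<le> (norm (cdot u (B *v k) + cdot k (B *v u)))\<^sup>2"
      by (simp add: Bk norm_add_squared flip: e_def)
    with k show ?thesis by blast
  next
    case False
    \<comment> \<open>Multiplying \<open>k\<close> by \<open>\<i>\<close> turns \<open>l\<close> into \<open>\<i> * l\<close> but \<open>e\<close> into \<open>- \<i> * e\<close>.\<close>
    define h where "h = \<i> *s k"
    have h: "cdot u h = 0" "norm h = 1"
      using k by (simp_all add: h_def cdot_smult_right norm_vsmult)
    have terms: "cdot u (B *v h) = \<i> * l" "cdot h (B *v u) = - (\<i> * e)" "norm (B *v h) = norm l"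
      by (simp_all add: h_def matrix_vector_mult_smult cdot_smult_left cdot_smult_right norm_vsmult
          Bk flip: e_def)
    have "(\<i> * l) \<bullet> (- (\<i> * e)) \<ge> 0"
      using False by (simp add: inner_complex_def)
    then have "(norm (B *v h))\<^sup>2 \<le> (norm (cdot u (B *v h) + cdot h (B *v u)))\<^sup>2"
      unfolding terms norm_add_squared by (simp add: norm_mult) (rule order_trans[of _ 0]; simp)
    with h show ?thesis by blast
  qed
qed

lemma rho_descent_at_critical:
  assumes u: "norm u = 1" and crit: "cproj_critical (rho_proj A) (cproj_class u)"
    and pos: "rho A u > 0"
  obtains h c where "cdot u h = 0" "norm h = 1" "rho_expansion A u h c" "c \<le> - 2 * rho A u"
proof -
  define B where "B = A - mat (zval A u)"
  have z: "zval B u = 0" and r: "rho B u = rho A u"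
    using u by (simp_all add: B_def resid_shift rho_shift)
  have curve: "rho A (hcurve u h t) = rho B (hcurve u h t)" if "cdot u h = 0" for h t
    using norm_hcurve[OF u, of h t] that by (simp add: B_def rho_shift horizontal_def)
  have stat: "(B *v u) \<bullet> (B *v h) = 0" if "cdot u h = 0" for h
    using DERIV_unique[OF rho_hcurve_derivative[OF u that z]
        cproj_critical_derivative[OF u crit that, unfolded curve[OF that]]] by simp
  obtain h where h: "cdot u h = 0" "norm h = 1"
      "(norm (B *v h))\<^sup>2 \<le> (norm (cdot u (B *v h) + cdot h (B *v u)))\<^sup>2"
    using exists_descent_direction[OF u z _ residual_adjoint_at_critical[OF u z stat]] pos r by auto
  have "rho_expansion B u h
      (2 * ((norm (B *v h))\<^sup>2 - rho A u - (norm (cdot u (B *v h) + cdot h (B *v u)))\<^sup>2))"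
    using rho_expansion_critical_direction[OF u h(1) z stat[OF h(1)]] h(2) r by simp
  then have "rho_expansion A u h
      (2 * ((norm (B *v h))\<^sup>2 - rho A u - (norm (cdot u (B *v h) + cdot h (B *v u)))\<^sup>2))"
    unfolding rho_expansion_def curve[OF h(1)] r .
  then show thesis by (rule that[OF h(1,2)]) (use h(3) in simp)
qed

section \<open>Local minima\<close>

text \<open>The projection from the sphere is continuous; only unit vectors represent points of \<open>\<complex>\<P>\<close>, so
  the approximating vectors have to be normalized.\<close>

lemma tendsto_cproj_class:
  assumes "(w \<longlongrightarrow> u) F" "norm u = 1" "\<And>t. norm (w t) = 1"
  shows "((\<lambda>t. cproj_class (w t)) \<longlongrightarrow> cproj_class u) F"
proof (rule topological_tendstoI)
  fix S assume "open S" "cproj_class u \<in> S"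
  then obtain T where T: "open T" "{v \<in> sphere 0 1. cproj_class v \<in> S} = sphere 0 1 \<inter> T"
    unfolding open_cproj_def openin_open by blast
  from T(2) have iff: "v \<in> T \<longleftrightarrow> cproj_class v \<in> S" if "norm v = 1" for v
    using that by (simp add: set_eq_iff) blast
  have "u \<in> T" using iff[OF assms(2)] \<open>cproj_class u \<in> S\<close> by blast
  with assms(1) T(1) have "\<forall>\<^sub>F t in F. w t \<in> T" by (rule topological_tendstoD)
  then show "\<forall>\<^sub>F t in F. cproj_class (w t) \<in> S"
    by (simp add: iff assms(3))
qed

lemma rho_expansion_negative_descends:
  assumes "rho_expansion A u h c" "c < 0"
  shows "\<forall>\<^sub>F t in at 0. rho A (hcurve u h t) < rho A u"
proof -
  obtain K where K: "\<forall>\<^sub>F t in at 0. norm (rho A (hcurve u h t) - (rho A u + t\<^sup>2 / 2 * c)) \<le> K * norm (t ^ 3)"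
    using assms(1) unfolding rho_expansion_def by (rule landau_o.bigE)
  have "((\<lambda>t. c / 2 + K * \<bar>t\<bar>) \<longlongrightarrow> c / 2 + K * \<bar>0\<bar>) (at (0::real))"
    by (intro tendsto_intros)
  then have "\<forall>\<^sub>F t in at (0::real). c / 2 + K * \<bar>t\<bar> < 0"
    by (rule order_tendstoD) (use assms(2) in simp)
  moreover have "\<forall>\<^sub>F t in at (0::real). t \<noteq> 0"
    by (simp add: eventually_at_filter)
  ultimately show ?thesis using K
  proof eventually_elim
    case (elim t)
    have "rho A (hcurve u h t) - rho A u \<le> t\<^sup>2 * (c / 2 + K * \<bar>t\<bar>)"
      using elim(3) by (simp add: abs_mult power3_eq_cube power2_eq_square algebra_simps abs_le_iff)
    also have "\<dots> < 0" using elim(1,2) by (simp add: mult_pos_neg)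
    finally show ?case by simp
  qed
qed

lemma not_local_min_of_descent:
  assumes u: "norm u = 1" and h: "cdot u h = 0" and "rho_expansion A u h c" "c < 0"
  shows "\<not> cproj_local_min (rho_proj A) (cproj_class u)"
proof
  assume "cproj_local_min (rho_proj A) (cproj_class u)"
  then have ev: "\<forall>\<^sub>F q in nhds (cproj_class u). rho A u \<le> rho_proj A q"
    using u by (simp add: cproj_local_min_def rho_proj_class)
  have n: "norm (hcurve u h t) = 1" for t
    using norm_hcurve[OF u] h by (simp add: horizontal_def)
  have "(hcurve u h \<longlongrightarrow> (u + 0 *\<^sub>R h) /\<^sub>R norm (u + 0 *\<^sub>R h)) (at 0)"
    unfolding hcurve_def using u by (intro tendsto_intros) auto
  then have "(hcurve u h \<longlongrightarrow> u) (at 0)" using u by simp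
  then have "((\<lambda>t. cproj_class (hcurve u h t)) \<longlongrightarrow> cproj_class u) (at 0)"
    by (rule tendsto_cproj_class[OF _ u n])
  with ev have "\<forall>\<^sub>F t in at 0. rho A u \<le> rho_proj A (cproj_class (hcurve u h t))"
    by (rule eventually_compose_filterlim)
  then have "\<forall>\<^sub>F t in at (0::real). False"
    using rho_expansion_negative_descends[OF assms(3,4)]
    by eventually_elim (simp add: rho_proj_class n)
  then show False by simp
qed

theorem theorem2p2:
  fixes A :: "complex ^ 'n ^ 'n" and u :: "complex ^ 'n"
  assumes "norm u = 1"
    and "cproj_critical (rho_proj A) (cproj_class u)"
  shows "((rho A u = 0) \<noteq> (rho A u > 0)) \<and>
    (rho A u = 0 \<longrightarrow> resid A u = 0 \<and> eigenvector A u) \<and>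
    (rho A u > 0 \<longrightarrow>
       (\<exists>h. cdot u h = 0 \<and> norm h = 1 \<and>
            rho_expansion A u h (hess_rho A u h) \<and>
            hess_rho A u h \<le> - 2 * rho A u)) \<and>
    (\<forall>p. cproj_critical (rho_proj A) p \<and> rho_proj A p > 0 \<longrightarrow>
         \<not> cproj_local_min (rho_proj A) p)"
proof (intro conjI impI allI)
  have "rho A u \<ge> 0" by (simp add: rho_def)
  then show "(rho A u = 0) \<noteq> (rho A u > 0)" by auto
  assume "rho A u = 0"
  then show R: "resid A u = 0" by (simp add: rho_def)
  have "u \<noteq> 0" using assms(1) by auto
  with R show "eigenvector A u" by (auto simp: eigenvector_def resid_def)
next
  assume "rho A u > 0"
  with assms obtain h c where "cdot u h = 0" "norm h = 1" "rho_expansion A u h c" "c \<le> - 2 * rho A u"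
    by (rule rho_descent_at_critical)
  then show "\<exists>h. cdot u h = 0 \<and> norm h = 1 \<and> rho_expansion A u h (hess_rho A u h) \<and>
      hess_rho A u h \<le> - 2 * rho A u"
    using hess_rho_eq by metis
next
  fix p assume p: "cproj_critical (rho_proj A) p \<and> rho_proj A p > 0"
  obtain v where v: "norm v = 1" "p = cproj_class v" using cproj_class_surj by blast
  then have pos: "rho A v > 0" using p by (simp add: rho_proj_class)
  obtain h c where "cdot v h = 0" "rho_expansion A v h c" "c \<le> - 2 * rho A v"
    using rho_descent_at_critical[OF v(1) _ pos] p v(2) by blast
  then show "\<not> cproj_local_min (rho_proj A) p"
    using not_local_min_of_descent[OF v(1)] pos v(2) by simp
qed

end
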